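(* Let $d,m\in\mathbb{N}$ with $m\ge 2$, and let $a_1,\ldots,a_m$ be distinct points of $\mathbb{R}^d$. Then the global optimal solution set $S_2\subset\mathbb{R}^{2d}$ of the problem $$\min\Big\{f_2(x_1,x_2)=\max_{1\le i\le m}\Big(\min_{\ell\in\{1,2\}}\|x_\ell-a_i\|\Big)\ \Big|\ (x_1,x_2)\in\mathbb{R}^d\times\mathbb{R}^d\Big\}$$ is compact.
   Context: $\|\cdot\|$ is the Euclidean norm on $\mathbb{R}^d$. $S_2$ is the set of all global minimizers of $f_2$ over $\mathbb{R}^d\times\mathbb{R}^d$. *)

theory Defs
  imports "HOL-Analysis.Analysis"
begin

definition f2 :: "(nat \<Rightarrow> real ^ 'd) \<Rightarrow> nat \<Rightarrow> (real ^ 'd) \<times> (real ^ 'd) \<Rightarrow> real" where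
  "f2 a m = (\<lambda>(x1, x2). MAX i\<in>{1..m}. min (norm (x1 - a i)) (norm (x2 - a i)))"

definition S2 :: "(nat \<Rightarrow> real ^ 'd) \<Rightarrow> nat \<Rightarrow> ((real ^ 'd) \<times> (real ^ 'd)) set" where
  "S2 a m = {x. is_arg_min (f2 a m) (\<lambda>_. True) x}"

end

theory Submission imports Defs begin

text \<open>
  The set of minimizers of the continuous function \<open>f2\<close> is closed, so only boundedness is at issue.
  Let \<open>r\<close> be the minimum. If one of the two centers were farther than \<open>r\<close> from every \<open>a i\<close>, then
  the other center \<open>c\<close> alone would cover all points with radius \<open>r\<close>, and \<open>r > 0\<close> because there are
  two distinct points. Splitting \<open>c\<close> into \<open>c + t u\<close> and \<open>c - t u\<close> along a direction \<open>u\<close> that is not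
  orthogonal to any nonzero \<open>a i - c\<close> strictly decreases the radius for small \<open>t > 0\<close>, which
  contradicts minimality. Hence both centers lie within \<open>r\<close> of the finite set of the \<open>a i\<close>.
\<close>

text \<open>Each nonzero \<open>v\<close> excludes only a hyperplane of directions, and finitely
  many hyperplanes form a null set, which cannot be the whole space.\<close>

lemma exists_nonorthogonal_direction:
  fixes V :: "'a::euclidean_space set"
  assumes "finite V" "0 \<notin> V"
  obtains u where "\<And>v. v \<in> V \<Longrightarrow> u \<bullet> v \<noteq> 0"
proof -
  have "negligible (\<Union>v\<in>V. {x. v \<bullet> x = 0})"
    using assms by (auto intro!: negligible_Union negligible_hyperplane)
  then have "(\<Union>v\<in>V. {x. v \<bullet> x = 0}) \<noteq> UNIV"
    using non_negligible_UNIV by metis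
  then obtain u where "u \<notin> (\<Union>v\<in>V. {x. v \<bullet> x = 0})" by blast
  then have "u \<bullet> v \<noteq> 0" if "v \<in> V" for v
    using that by (auto simp: inner_commute)
  then show thesis by (rule that)
qed

text \<open>The squared norm changes by
  \<open>t * (t * (u \<bullet> u) - 2 * (u \<bullet> v))\<close>, which is negative for
  \<open>t\<close> strictly between 0 and
  \<open>2 * (u \<bullet> v) / (u \<bullet> u)\<close>.\<close>

lemma eventually_norm_diff_scaleR_less:
  fixes u v :: "'a::real_inner"
  assumes "norm v \<le> r" "u \<bullet> v > 0"
  shows "eventually (\<lambda>t. norm (v - t *\<^sub>R u) < r) (at_right 0)"
proof -
  have u: "u \<bullet> u > 0" using assms(2) by auto
  have "eventually (\<lambda>t. t \<in> {0<..<2 * (u \<bullet> v) / (u \<bullet> u)}) (at_right (0::real))"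
    using assms(2) u by (intro eventually_at_right_real) auto
  then show ?thesis
  proof eventually_elim
    case (elim t)
    then have "t * (t * (u \<bullet> u)) < t * (2 * (u \<bullet> v))"
      using u by (intro mult_strict_left_mono) (auto simp: field_simps)
    then have "(norm (v - t *\<^sub>R u))\<^sup>2 < (norm v)\<^sup>2"
      by (simp add: power2_norm_eq_inner inner_diff inner_commute algebra_simps)
    then have "norm (v - t *\<^sub>R u) < norm v"
      by (rule power_less_imp_less_base) simp
    with assms(1) show ?case by simp
  qed
qed

text \<open>Each index is served by all sufficiently small \<open>t > 0\<close>; finiteness of
  \<open>I\<close> yields a common \<open>t\<close>.\<close>

lemma two_centers_beat_one:
  fixes a :: "'i \<Rightarrow> 'a::euclidean_space"
  assumes "finite I" "r > 0" and le: "\<And>i. i \<in> I \<Longrightarrow> norm (c - a i) \<le> r"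
  obtains y z where "\<And>i. i \<in> I \<Longrightarrow> min (norm (y - a i)) (norm (z - a i)) < r"
proof -
  obtain u where u: "\<And>v. v \<in> (\<lambda>i. c - a i) ` I - {0} \<Longrightarrow> u \<bullet> v \<noteq> 0"
    using exists_nonorthogonal_direction[of "(\<lambda>i. c - a i) ` I - {0}"] assms(1) by auto
  have "\<forall>\<^sub>F t in at_right 0.
      min (norm (c - t *\<^sub>R u - a i)) (norm (c + t *\<^sub>R u - a i)) < r" if i: "i \<in> I" for i
  proof -
    \<comment> \<open>A point at \<open>c\<close> itself stays within \<open>r\<close> by
      continuity, since \<open>r > 0\<close>. Otherwise the sign of the inner product decides which
      of \<open>c - t *\<^sub>R u\<close> and \<open>c + t *\<^sub>R u\<close> moves closer to
      \<open>a i\<close>.\<close>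
    consider "c - a i = 0" | "u \<bullet> (c - a i) > 0" | "(- u) \<bullet> (c - a i) > 0"
      using u[of "c - a i"] i by (cases "c - a i = 0") (auto simp: neq_iff)
    then show ?thesis
    proof cases
      case 1
      have "((\<lambda>t. norm (t *\<^sub>R u)) \<longlongrightarrow> norm (0 *\<^sub>R u)) (at_right 0)"
        by (intro tendsto_intros)
      then have "\<forall>\<^sub>F t in at_right 0. norm (t *\<^sub>R u) < r"
        using assms(2) by (intro order_tendstoD(2)) auto
      then show ?thesis
        using 1 by (auto elim!: eventually_mono)
    next
      case 2
      show ?thesis
        using eventually_norm_diff_scaleR_less[OF le[OF i] 2]
        by eventually_elim (simp add: algebra_simps)
    next
      case 3
      show ?thesis
        using eventually_norm_diff_scaleR_less[OF le[OF i] 3]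
        by eventually_elim (simp add: algebra_simps)
    qed
  qed
  then have "\<forall>\<^sub>F t in at_right 0. \<forall>i\<in>I.
      min (norm (c - t *\<^sub>R u - a i)) (norm (c + t *\<^sub>R u - a i)) < r"
    using assms(1) by (intro eventually_ball_finite) auto
  then obtain t where "\<forall>i\<in>I. min (norm (c - t *\<^sub>R u - a i)) (norm (c + t *\<^sub>R u - a i)) < r"
    using eventually_happens' trivial_limit_at_right_real by blast
  then show thesis by (intro that) blast
qed

lemma continuous_on_Max_image:
  fixes f :: "'i \<Rightarrow> 'a::topological_space \<Rightarrow> 'b::linorder_topology"
  assumes "finite I" "I \<noteq> {}" "\<And>i. i \<in> I \<Longrightarrow> continuous_on S (f i)"
  shows "continuous_on S (\<lambda>x. MAX i\<in>I. f i x)"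
  using assms
proof (induction rule: finite_ne_induct)
  case (insert i I)
  then have "continuous_on S (\<lambda>x. max (f i x) (MAX j\<in>I. f j x))"
    by (intro continuous_on_max) auto
  with insert show ?case by simp
qed auto

lemma continuous_on_f2:
  assumes "m \<ge> 1"
  shows "continuous_on S (f2 a m)"
  unfolding f2_def split_beta using assms
  by (intro continuous_on_Max_image continuous_intros) auto

lemma f2_less_iff:
  assumes "m \<ge> 1"
  shows "f2 a m (x, y) < r \<longleftrightarrow> (\<forall>i\<in>{1..m}. min (norm (x - a i)) (norm (y - a i)) < r)"
  using assms unfolding f2_def by (simp add: Max_less_iff)

lemma f2_le_iff:
  assumes "m \<ge> 1"
  shows "f2 a m (x, y) \<le> r \<longleftrightarrow> (\<forall>i\<in>{1..m}. min (norm (x - a i)) (norm (y - a i)) \<le> r)"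
  using assms unfolding f2_def by (simp add: Max_le_iff)

lemma f2_swap: "f2 a m (y, x) = f2 a m (x, y)"
  by (simp add: f2_def min.commute)

lemma S2_iff: "p \<in> S2 a m \<longleftrightarrow> (\<forall>q. f2 a m p \<le> f2 a m q)"
  by (auto simp: S2_def is_arg_min_def not_less)

lemma S2_swap: "(x, y) \<in> S2 a m \<Longrightarrow> (y, x) \<in> S2 a m"
  by (simp add: S2_iff f2_swap)

lemma S2_fst_near_point:
  assumes "m \<ge> 2" "inj_on a {1..m}" and S: "(x, y) \<in> S2 a m"
  obtains i where "i \<in> {1..m}" "norm (x - a i) \<le> f2 a m (x, y)"
proof (rule ccontr)
  define r where "r = f2 a m (x, y)"
  have m: "m \<ge> 1" using assms(1) by simp
  assume "\<not> thesis"
  then have far: "norm (x - a i) > r" if "i \<in> {1..m}" for i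
    using that \<open>\<And>i. \<lbrakk>i \<in> {1..m}; norm (x - a i) \<le> f2 a m (x, y)\<rbrakk> \<Longrightarrow> thesis\<close>
    unfolding r_def by (meson not_less)
  have "f2 a m (x, y) \<le> r" by (simp add: r_def)
  \<comment> \<open>As \<open>x\<close> is too far from every point, the minimum of the two
    distances can be at most \<open>r\<close> only through \<open>y\<close>.\<close>
  then have near: "norm (y - a i) \<le> r" if "i \<in> {1..m}" for i
    using far[OF that] that by (force simp: f2_le_iff[OF m] min_le_iff_disj)
  \<comment> \<open>With \<open>r = 0\<close>, the center \<open>y\<close> would coincide with both
    of these distinct points.\<close>
  have "a 1 \<noteq> a 2" using assms(1,2) by (auto dest: inj_onD[of _ _ 1 2])
  then have "r > 0"
    using near[of 1] near[of 2] assms(1)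
    by (smt (verit) atLeastAtMost_iff norm_ge_zero norm_le_zero_iff one_le_numeral
        order.refl right_minus_eq m)
  then obtain p q where "\<And>i. i \<in> {1..m} \<Longrightarrow> min (norm (p - a i)) (norm (q - a i)) < r"
    using two_centers_beat_one[of "{1..m}" r y a] near by blast
  then have "f2 a m (p, q) < r" by (simp add: f2_less_iff[OF m])
  moreover have "r \<le> f2 a m (p, q)" using S unfolding S2_iff r_def by blast
  ultimately show False by simp
qed

theorem theorem2p12:
  fixes a :: "nat \<Rightarrow> real ^ 'd" and m :: nat
  assumes "m \<ge> 2"
    and "inj_on a {1..m}"
  shows "compact (S2 a m)"
proof -
  have "S2 a m = (\<Inter>q. {p. f2 a m p \<le> f2 a m q})"
    by (auto simp: S2_iff)
  moreover have "closed {p. f2 a m p \<le> f2 a m q}" for q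
    using assms(1) by (intro closed_Collect_le continuous_on_f2 continuous_on_const) auto
  ultimately have "closed (S2 a m)" by auto
  moreover have "bounded (S2 a m)"
  proof -
    \<comment> \<open>The value at \<open>(0, 0)\<close> bounds the minimum from above, so one
      radius serves all minimizers.\<close>
    define K where "K = (\<Union>i\<in>{1..m}. cball (a i) (f2 a m (0, 0)))"
    have fst: "x \<in> K" if S: "(x, y) \<in> S2 a m" for x y
    proof -
      obtain i where "i \<in> {1..m}" "norm (x - a i) \<le> f2 a m (x, y)"
        using S2_fst_near_point[OF assms S] .
      moreover have "f2 a m (x, y) \<le> f2 a m (0, 0)"
        using S by (simp add: S2_iff)
      ultimately show ?thesis
        unfolding K_def by (force simp: dist_norm norm_minus_commute)
    qed
    \<comment> \<open>Exchanging the centers preserves optimality, so the bound on the first one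
      carries over to the second.\<close>
    then have "S2 a m \<subseteq> K \<times> K"
      using S2_swap by fastforce
    moreover have "bounded K" unfolding K_def by auto
    ultimately show ?thesis
      using bounded_Times bounded_subset by blast
  qed
  ultimately show ?thesis
    by (simp add: compact_eq_bounded_closed)
qed

end
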